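(* Let $\mathcal{A}\in T_{m,n}$, $q\in\mathbb{R}^n$ and $p\in(0,1)$. Let $\{t_k\}$ be any sequence of positive real numbers converging to $0$ and, for each $k$, let $u_{t_k}$ be a solution (global minimizer) of $$\min_{u\in\mathbb{R}^n}\ \tfrac12\|\Phi_{FB}(u)\|^2+t\|u\|_p^p$$ with $t=t_k$. If $\mathrm{SOL}(q,\mathcal{A})$ is nonempty, then the sequence $\{u_{t_k}\}$ has at least one accumulation point, and any accumulation point $u^*$ of $\{u_{t_k}\}$ is a minimal $l_p$ norm solution of $\mathrm{TCP}(q,\mathcal{A})$, i.e. $u^*\in\mathrm{SOL}(q,\mathcal{A})$ and $\|u^*\|_p^p\le\|\bar u\|_p^p$ for every $\bar u\in\mathrm{SOL}(q,\mathcal{A})$.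
   Context: $T_{m,n}$ is the set of real tensors $\mathcal{A}=(a_{i_1\ldots i_m})$ of order $m\ge 2$ and dimension $n$. For $u\in\mathbb{R}^n$, $\mathcal{A}u^{m-1}\in\mathbb{R}^n$ is the vector with $(\mathcal{A}u^{m-1})_i=\sum_{i_2,\ldots,i_m=1}^n a_{i i_2\ldots i_m}u_{i_2}\cdots u_{i_m}$. $\mathrm{SOL}(q,\mathcal{A})=\{u\in\mathbb{R}^n: u\ge 0,\ \mathcal{A}u^{m-1}+q\ge 0,\ u^T(\mathcal{A}u^{m-1}+q)=0\}$ (componentwise inequalities) is the solution set of the tensor complementarity problem $\mathrm{TCP}(q,\mathcal{A})$. The Fischer-Burmeister function is $\phi_{FB}(a,b)=\sqrt{a^2+b^2}-(a+b)$ for $a,b\in\mathbb{R}$, and $\Phi_{FB}:\mathbb{R}^n\to\mathbb{R}^n$ is defined by $\Phi_{FB}(u)_i=\phi_{FB}(u_i,(q+\mathcal{A}u^{m-1})_i)$, $i=1,\ldots,n$. $\|\cdot\|$ is the Euclidean norm and $\|u\|_p^p=\sum_{i=1}^n|u_i|^p$. *)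

theory Defs
  imports "HOL-Analysis.Analysis"
begin

text \<open>
  A tensor of order \<open>m\<close> and dimension \<open>CARD('n)\<close> is a function on index lists
  \<open>[i\<^sub>1, \<dots>, i\<^sub>m]\<close>. Entries at lists of any other length are set to 0, so that each
  tensor has exactly one representative.
\<close>

definition tensors :: "nat \<Rightarrow> ('n::finite list \<Rightarrow> real) set" where
  "tensors m = {A. \<forall>is. length is \<noteq> m \<longrightarrow> A is = 0}"

text \<open>The vector \<open>\<A>u\<^sup>m\<^sup>-\<^sup>1\<close>; meaningful for \<open>m \<ge> 1\<close>.\<close>

definition tensor_app :: "nat \<Rightarrow> ('n::finite list \<Rightarrow> real) \<Rightarrow> real ^ 'n \<Rightarrow> real ^ 'n" where
  "tensor_app m A u =
     (\<chi> i. \<Sum>js | length js = m - 1. A (i # js) * (\<Prod>j\<leftarrow>js. u $ j))"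

text \<open>The order on \<open>real ^ 'n\<close> is the componentwise one.\<close>

definition SOL :: "nat \<Rightarrow> real ^ 'n \<Rightarrow> ('n::finite list \<Rightarrow> real) \<Rightarrow> (real ^ 'n) set" where
  "SOL m q A = {u. 0 \<le> u \<and> 0 \<le> tensor_app m A u + q \<and> u \<bullet> (tensor_app m A u + q) = 0}"

definition phi_FB :: "real \<Rightarrow> real \<Rightarrow> real" where
  "phi_FB a b = sqrt (a\<^sup>2 + b\<^sup>2) - (a + b)"

definition Phi_FB ::
    "nat \<Rightarrow> real ^ 'n \<Rightarrow> ('n::finite list \<Rightarrow> real) \<Rightarrow> real ^ 'n \<Rightarrow> real ^ 'n" where
  "Phi_FB m q A u = (\<chi> i. phi_FB (u $ i) ((q + tensor_app m A u) $ i))"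

text \<open>
  \<open>\<parallel>u\<parallel>\<^sub>p\<^sup>p\<close>, without the outer \<open>p\<close>-th root. As \<open>0 powr p = 0\<close>, zero components
  contribute 0 for \<open>p > 0\<close>.
\<close>

definition lp_pow :: "real \<Rightarrow> real ^ 'n::finite \<Rightarrow> real" where
  "lp_pow p u = (\<Sum>i\<in>UNIV. \<bar>u $ i\<bar> powr p)"

definition FB_objective ::
    "nat \<Rightarrow> real ^ 'n \<Rightarrow> ('n::finite list \<Rightarrow> real) \<Rightarrow> real \<Rightarrow> real \<Rightarrow> real ^ 'n \<Rightarrow> real" where
  "FB_objective m q A p t u = 1/2 * (norm (Phi_FB m q A u))\<^sup>2 + t * lp_pow p u"

definition minimal_lp_solution ::
    "nat \<Rightarrow> real ^ 'n \<Rightarrow> ('n::finite list \<Rightarrow> real) \<Rightarrow> real \<Rightarrow> real ^ 'n \<Rightarrow> bool" where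
  "minimal_lp_solution m q A p u \<longleftrightarrow>
     u \<in> SOL m q A \<and> (\<forall>v\<in>SOL m q A. lp_pow p u \<le> lp_pow p v)"

definition accumulation_point :: "(nat \<Rightarrow> 'a::metric_space) \<Rightarrow> 'a \<Rightarrow> bool" where
  "accumulation_point x l \<longleftrightarrow> (\<exists>r. strict_mono r \<and> (x \<circ> r) \<longlonglongrightarrow> l)"

end

theory Submission
  imports Defs
begin

text \<open>
  The zeros of the Fischer-Burmeister map are exactly the solutions of the complementarity
  problem, because \<open>sqrt (a\<^sup>2 + b\<^sup>2) = a + b\<close> forces \<open>a, b \<ge> 0\<close> and
  \<open>a * b = 0\<close>. Hence on \<open>SOL m q A\<close> the residual term of the objective vanishes, and
  comparing a global minimizer \<open>u\<close> for the parameter \<open>t > 0\<close> with a solution \<open>v\<close> gives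
  \<open>1/2 * (norm (Phi_FB m q A u))\<^sup>2 + t * lp_pow p u \<le> t * lp_pow p v\<close>
  (\<open>minimizer_compare_solution\<close>). Since both summands on the left are nonnegative, this one
  inequality yields two bounds, and each carries one half of the theorem.

  The first bound, \<open>lp_pow p u \<le> lp_pow p v\<close>, is uniform in \<open>t\<close>. As \<open>lp_pow p\<close> has bounded
  sublevel sets (\<open>norm_le_of_lp_pow_le\<close>), any sequence of minimizers is bounded, so
  it has an accumulation point; by continuity of \<open>lp_pow p\<close> the bound survives in the limit,
  for every solution \<open>v\<close>.

  The second bound, \<open>(norm (Phi_FB m q A u))\<^sup>2 \<le> 2 * t * lp_pow p v\<close>, tends to \<open>0\<close> with
  \<open>t\<close>. Continuity of \<open>Phi_FB m q A\<close> therefore makes it vanish at every accumulation point,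
  which is thus a solution.
\<close>

text \<open>
  The equation says that the hypotenuse of a right triangle equals the sum of its legs;
  squaring it leaves \<open>2 * a * b = 0\<close>, and the sign conditions come from \<open>a + b \<ge> 0\<close>.
\<close>

lemma phi_FB_eq_0_iff: "phi_FB a b = 0 \<longleftrightarrow> 0 \<le> a \<and> 0 \<le> b \<and> a * b = 0"
proof
  assume "phi_FB a b = 0"
  then have eq: "sqrt (a\<^sup>2 + b\<^sup>2) = a + b"
    by (simp add: phi_FB_def)
  then have nonneg: "0 \<le> a + b"
    by (metis real_sqrt_ge_zero sum_power2_ge_zero)
  have "a\<^sup>2 + b\<^sup>2 = (a + b)\<^sup>2"
    using eq by (metis real_sqrt_pow2 sum_power2_ge_zero)
  then have "a * b = 0"
    by (simp add: power2_sum)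
  with nonneg show "0 \<le> a \<and> 0 \<le> b \<and> a * b = 0"
    by auto
next
  assume "0 \<le> a \<and> 0 \<le> b \<and> a * b = 0"
  then show "phi_FB a b = 0"
    by (auto simp: phi_FB_def)
qed

text \<open>
  For nonnegative vectors orthogonality is a componentwise condition: a sum of nonnegative
  products vanishes only if every product does.
\<close>

lemma Phi_FB_eq_0_iff: "Phi_FB m q A u = 0 \<longleftrightarrow> u \<in> SOL m q A"
proof -
  define w where "w = tensor_app m A u + q"
  have "u \<bullet> w = 0 \<longleftrightarrow> (\<forall>i. u $ i * w $ i = 0)" if "0 \<le> u" "0 \<le> w"
    using that by (simp add: inner_vec_def less_eq_vec_def sum_nonneg_eq_0_iff)
  then show ?thesis
    by (auto simp: SOL_def Phi_FB_def vec_eq_iff phi_FB_eq_0_iff less_eq_vec_def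
        w_def add.commute)
qed

lemma tendsto_prod_list:
  fixes f :: "'b \<Rightarrow> 'a \<Rightarrow> real"
  assumes "\<And>j. j \<in> set js \<Longrightarrow> (f j \<longlongrightarrow> l j) F"
  shows "((\<lambda>x. \<Prod>j\<leftarrow>js. f j x) \<longlongrightarrow> (\<Prod>j\<leftarrow>js. l j)) F"
  using assms by (induction js) (auto intro!: tendsto_mult)

lemma tendsto_Phi_FB:
  assumes "(u \<longlongrightarrow> l) F"
  shows "((\<lambda>x. Phi_FB m q A (u x)) \<longlongrightarrow> Phi_FB m q A l) F"
proof -
  have "((\<lambda>x. tensor_app m A (u x)) \<longlongrightarrow> tensor_app m A l) F"
    unfolding tensor_app_def
    by (intro tendsto_vec_lambda tendsto_sum tendsto_mult tendsto_const tendsto_prod_list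
        tendsto_vec_nth assms)
  then show ?thesis
    unfolding Phi_FB_def phi_FB_def
    by (intro tendsto_vec_lambda tendsto_intros assms)
qed

lemma tendsto_lp_pow:
  assumes "0 < p" and "(u \<longlongrightarrow> l) F"
  shows "((\<lambda>x. lp_pow p (u x)) \<longlongrightarrow> lp_pow p l) F"
  unfolding lp_pow_def using assms
  by (intro tendsto_sum tendsto_powr' tendsto_rabs tendsto_vec_nth tendsto_const) auto

lemma lp_pow_nonneg: "0 \<le> lp_pow p u"
  by (simp add: lp_pow_def sum_nonneg)

text \<open>
  Coercivity of the regularization term. A single component already satisfies
  \<open>\<bar>u $ i\<bar> powr p \<le> c\<close>, and for \<open>p > 0\<close> this can be inverted.
\<close>

lemma norm_le_of_lp_pow_le:
  fixes u :: "real ^ 'n::finite"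
  assumes "0 < p" and "lp_pow p u \<le> c"
  shows "norm u \<le> real CARD('n) * c powr (1 / p)"
proof -
  have "\<bar>u $ i\<bar> \<le> c powr (1 / p)" for i
  proof -
    have "\<bar>u $ i\<bar> powr p \<le> lp_pow p u"
      unfolding lp_pow_def by (rule member_le_sum) auto
    with assms have "(\<bar>u $ i\<bar> powr p) powr (1 / p) \<le> c powr (1 / p)"
      by (intro powr_mono2) auto
    then show ?thesis
      using \<open>0 < p\<close> by (simp add: powr_powr)
  qed
  then have "(\<Sum>i\<in>UNIV. \<bar>u $ i\<bar>) \<le> real CARD('n) * c powr (1 / p)"
    by (intro sum_bounded_above) auto
  then show ?thesis
    using norm_le_l1_cart[of u] by linarith
qed

lemma minimizer_compare_solution:
  assumes "is_arg_min (FB_objective m q A p t) (\<lambda>_. True) u" and "v \<in> SOL m q A"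
  shows "1/2 * (norm (Phi_FB m q A u))\<^sup>2 + t * lp_pow p u \<le> t * lp_pow p v"
proof -
  have "FB_objective m q A p t u \<le> FB_objective m q A p t v"
    using assms(1) by (auto simp: is_arg_min_def not_less)
  moreover have "Phi_FB m q A v = 0"
    using assms(2) by (simp add: Phi_FB_eq_0_iff)
  ultimately show ?thesis
    by (simp add: FB_objective_def)
qed

lemma minimizer_lp_pow_le:
  assumes "is_arg_min (FB_objective m q A p t) (\<lambda>_. True) u" and "v \<in> SOL m q A" and "0 < t"
  shows "lp_pow p u \<le> lp_pow p v"
proof -
  have "0 \<le> 1/2 * (norm (Phi_FB m q A u))\<^sup>2"
    by simp
  with minimizer_compare_solution[OF assms(1,2)] have "t * lp_pow p u \<le> t * lp_pow p v"
    by linarith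
  with \<open>0 < t\<close> show ?thesis
    by simp
qed

lemma minimizer_residual_le:
  assumes "is_arg_min (FB_objective m q A p t) (\<lambda>_. True) u" and "v \<in> SOL m q A" and "0 < t"
  shows "(norm (Phi_FB m q A u))\<^sup>2 \<le> 2 * t * lp_pow p v"
proof -
  have "0 \<le> t * lp_pow p u"
    using \<open>0 < t\<close> by (simp add: lp_pow_nonneg)
  with minimizer_compare_solution[OF assms(1,2)] show ?thesis
    by linarith
qed

theorem theorem3p4:
  fixes m :: nat
    and A :: "'n::finite list \<Rightarrow> real"
    and q :: "real ^ 'n"
    and p :: real
    and t :: "nat \<Rightarrow> real"
    and u :: "nat \<Rightarrow> real ^ 'n"
  assumes "m \<ge> 2"
    and "A \<in> tensors m"
    and "0 < p" and "p < 1"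
    and "\<And>k. t k > 0"
    and "t \<longlonglongrightarrow> 0"
    and "\<And>k. is_arg_min (FB_objective m q A p (t k)) (\<lambda>_. True) (u k)"
    and "SOL m q A \<noteq> {}"
  shows "(\<exists>l. accumulation_point u l) \<and>
         (\<forall>l. accumulation_point u l \<longrightarrow> minimal_lp_solution m q A p l)"
proof -
  obtain v where v: "v \<in> SOL m q A"
    using assms(8) by auto
  have "range u \<subseteq> cball 0 (real CARD('n) * lp_pow p v powr (1 / p))"
    using norm_le_of_lp_pow_le[OF assms(3) minimizer_lp_pow_le[OF assms(7) v assms(5)]]
    by auto
  then have "bounded (range u)"
    using bounded_cball bounded_subset by blast
  then have ex: "\<exists>l. accumulation_point u l"
    using bounded_imp_convergent_subsequence unfolding accumulation_point_def by blast

  have "minimal_lp_solution m q A p l" if acc: "accumulation_point u l" for l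
  proof -
    obtain r where r: "strict_mono r" and lim: "(\<lambda>k. u (r k)) \<longlonglongrightarrow> l"
      using acc by (auto simp: accumulation_point_def o_def)
    have "(\<lambda>k. t (r k)) \<longlonglongrightarrow> 0"
      using LIMSEQ_subseq_LIMSEQ[OF assms(6) r] by (simp add: o_def)
    then have "(\<lambda>k. 2 * t (r k) * lp_pow p v) \<longlonglongrightarrow> 2 * 0 * lp_pow p v"
      by (intro tendsto_intros)
    moreover have "(\<lambda>k. (norm (Phi_FB m q A (u (r k))))\<^sup>2) \<longlonglongrightarrow> (norm (Phi_FB m q A l))\<^sup>2"
      by (intro tendsto_intros tendsto_Phi_FB lim)
    ultimately have "(norm (Phi_FB m q A l))\<^sup>2 \<le> 2 * 0 * lp_pow p v"
      using minimizer_residual_le[OF assms(7) v assms(5)] by (intro LIMSEQ_le) auto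
    then have "l \<in> SOL m q A"
      by (simp flip: Phi_FB_eq_0_iff)
    moreover have "lp_pow p l \<le> lp_pow p w" if w: "w \<in> SOL m q A" for w
      using minimizer_lp_pow_le[OF assms(7) w assms(5)]
      by (intro LIMSEQ_le_const2[OF tendsto_lp_pow[OF assms(3) lim]]) auto
    ultimately show ?thesis
      by (simp add: minimal_lp_solution_def)
  qed
  with ex show ?thesis
    by blast
qed

end
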